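(* An ordered semigroup $S$ (without zero) is right Clifford if and only if $S$ is right inverse and $a\in (a^2Sa]$ for every $a\in S$.
   Context: An ordered semigroup $(S,\cdot,\leq)$ is a semigroup with a partial order such that $a\leq b$ implies $xa\leq xb$ and $ax\leq bx$ for all $x\in S$. Standing assumption: the ambient ordered semigroup $S$ has no zero element (an element $0$ with $0x=x0=0$ and $0\leq x$ for all $x\in S$). For $H\subseteq S$, $(H]=\{t\in S: t\leq h \text{ for some } h\in H\}$. For $a\in S$: $aS=\{as:s\in S\}$, $Sa=\{sa:s\in S\}$, $a^2Sa=\{a^2sa:s\in S\}$. $S$ is regular if $a\in (aSa]$ for every $a\in S$. $S$ is right Clifford if it is regular and $(Sa]\subseteq (aS]$ for every $a\in S$. A nonempty $I\subseteq S$ is a left (right) ideal if $SI\subseteq I$ ($IS\subseteq I$) and $(I]\subseteq I$. $L(a)$ and $R(a)$ denote the smallest left, respectively right, ideal containing $a$. Green's relation: $a\,\mathcal{R}\,b$ iff $R(a)=R(b)$. $E_{\leq}(S)=\{e\in S: e\leq e^2\}$ is the set of ordered idempotents. $S$ is right inverse if it is regular and every principal left ideal is generated by an $\mathcal{R}$-unique ordered idempotent, i.e. for every $a\in S$ there is $e\in E_{\leq}(S)$ with $L(a)=L(e)$, and any two $e,f\in E_{\leq}(S)$ with $L(e)=L(a)=L(f)$ satisfy $e\,\mathcal{R}\,f$. *)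

theory Defs
  imports Main
begin

class ordered_semigroup = semigroup_mult + order +
  assumes mult_left_mono_os: "a \<le> b \<Longrightarrow> x * a \<le> x * b"
    and mult_right_mono_os: "a \<le> b \<Longrightarrow> a * x \<le> b * x"

text \<open>The ordered semigroup \<open>S\<close> is the whole type \<open>'a\<close>; properties of \<open>S\<close> itself are
  predicates on \<open>TYPE('a)\<close>.\<close>

definition has_zero :: "'a::ordered_semigroup itself \<Rightarrow> bool" where
  "has_zero _ \<longleftrightarrow> (\<exists>z::'a. \<forall>x. z * x = z \<and> x * z = z \<and> z \<le> x)"

text \<open>\<open>downset H\<close> is written \<open>(H]\<close> in the literature.\<close>

definition downset :: "'a::ordered_semigroup set \<Rightarrow> 'a set" where
  "downset H = {t. \<exists>h\<in>H. t \<le> h}"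

definition left_ideal :: "'a::ordered_semigroup set \<Rightarrow> bool" where
  "left_ideal I \<longleftrightarrow> I \<noteq> {} \<and> {s * x | s x. x \<in> I} \<subseteq> I \<and> downset I \<subseteq> I"

definition right_ideal :: "'a::ordered_semigroup set \<Rightarrow> bool" where
  "right_ideal I \<longleftrightarrow> I \<noteq> {} \<and> {x * s | x s. x \<in> I} \<subseteq> I \<and> downset I \<subseteq> I"

definition principal_left_ideal :: "'a::ordered_semigroup \<Rightarrow> 'a set" where
  "principal_left_ideal a = \<Inter> {I. left_ideal I \<and> a \<in> I}"

definition principal_right_ideal :: "'a::ordered_semigroup \<Rightarrow> 'a set" where
  "principal_right_ideal a = \<Inter> {I. right_ideal I \<and> a \<in> I}"

lemma principal_left_ideal_least:
  "left_ideal (principal_left_ideal a)" "a \<in> principal_left_ideal a"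
  "left_ideal I \<Longrightarrow> a \<in> I \<Longrightarrow> principal_left_ideal a \<subseteq> I"
proof -
  show mem: "a \<in> principal_left_ideal a"
    by (simp add: principal_left_ideal_def)
  show least: "principal_left_ideal a \<subseteq> I" if "left_ideal I" "a \<in> I" for I
    unfolding principal_left_ideal_def using that by (intro Inter_lower) simp
  have mult: "{s * x | s x. x \<in> principal_left_ideal a} \<subseteq> I"
    and down: "downset (principal_left_ideal a) \<subseteq> I" if "left_ideal I" "a \<in> I" for I
  proof -
    have "{s * x | s x. x \<in> I} \<subseteq> I" "downset I \<subseteq> I"
      using that(1) unfolding left_ideal_def by (blast, blast)
    moreover have "{s * x | s x. x \<in> principal_left_ideal a} \<subseteq> {s * x | s x. x \<in> I}"
      using least[OF that] by blast
    moreover have "downset (principal_left_ideal a) \<subseteq> downset I"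
      unfolding downset_def using least[OF that] by blast
    ultimately show "{s * x | s x. x \<in> principal_left_ideal a} \<subseteq> I"
      "downset (principal_left_ideal a) \<subseteq> I"
      by (meson subset_trans)+
  qed
  have "{s * x | s x. x \<in> principal_left_ideal a} \<subseteq> principal_left_ideal a"
    by (subst (2) principal_left_ideal_def, rule Inter_greatest, rule mult) simp_all
  moreover have "downset (principal_left_ideal a) \<subseteq> principal_left_ideal a"
    by (subst (2) principal_left_ideal_def, rule Inter_greatest, rule down) simp_all
  ultimately show "left_ideal (principal_left_ideal a)"
    unfolding left_ideal_def using mem by (intro conjI) auto
qed

lemma principal_right_ideal_least:
  "right_ideal (principal_right_ideal a)" "a \<in> principal_right_ideal a"
  "right_ideal I \<Longrightarrow> a \<in> I \<Longrightarrow> principal_right_ideal a \<subseteq> I"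
proof -
  show mem: "a \<in> principal_right_ideal a"
    by (simp add: principal_right_ideal_def)
  show least: "principal_right_ideal a \<subseteq> I" if "right_ideal I" "a \<in> I" for I
    unfolding principal_right_ideal_def using that by (intro Inter_lower) simp
  have mult: "{x * s | s x. x \<in> principal_right_ideal a} \<subseteq> I"
    and down: "downset (principal_right_ideal a) \<subseteq> I" if "right_ideal I" "a \<in> I" for I
  proof -
    have "{x * s | s x. x \<in> I} \<subseteq> I" "downset I \<subseteq> I"
      using that(1) unfolding right_ideal_def by (blast, blast)
    moreover have "{x * s | s x. x \<in> principal_right_ideal a} \<subseteq> {x * s | s x. x \<in> I}"
      using least[OF that] by blast
    moreover have "downset (principal_right_ideal a) \<subseteq> downset I"
      unfolding downset_def using least[OF that] by blast
    ultimately show "{x * s | s x. x \<in> principal_right_ideal a} \<subseteq> I"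
      "downset (principal_right_ideal a) \<subseteq> I"
      by (meson subset_trans)+
  qed
  have "{x * s | s x. x \<in> principal_right_ideal a} \<subseteq> principal_right_ideal a"
    by (subst (2) principal_right_ideal_def, rule Inter_greatest, rule mult) simp_all
  moreover have "downset (principal_right_ideal a) \<subseteq> principal_right_ideal a"
    by (subst (2) principal_right_ideal_def, rule Inter_greatest, rule down) simp_all
  ultimately show "right_ideal (principal_right_ideal a)"
    unfolding right_ideal_def using mem by (intro conjI) auto
qed

definition green_R :: "'a::ordered_semigroup \<Rightarrow> 'a \<Rightarrow> bool" where
  "green_R a b \<longleftrightarrow> principal_right_ideal a = principal_right_ideal b"

definition ordered_idempotents :: "'a::ordered_semigroup set" where
  "ordered_idempotents = {e. e \<le> e * e}"

definition regular_semigroup :: "'a::ordered_semigroup itself \<Rightarrow> bool" where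
  "regular_semigroup _ \<longleftrightarrow> (\<forall>a::'a. a \<in> downset {a * s * a | s. True})"

definition right_clifford :: "'a::ordered_semigroup itself \<Rightarrow> bool" where
  "right_clifford T \<longleftrightarrow> regular_semigroup T \<and>
     (\<forall>a::'a. downset {s * a | s. True} \<subseteq> downset {a * s | s. True})"

definition right_inverse_semigroup :: "'a::ordered_semigroup itself \<Rightarrow> bool" where
  "right_inverse_semigroup T \<longleftrightarrow> regular_semigroup T \<and>
     (\<forall>a::'a.
       (\<exists>e\<in>ordered_idempotents. principal_left_ideal a = principal_left_ideal e) \<and>
       (\<forall>e\<in>ordered_idempotents. \<forall>f\<in>ordered_idempotents.
          principal_left_ideal e = principal_left_ideal a \<longrightarrow>
          principal_left_ideal f = principal_left_ideal a \<longrightarrow> green_R e f))"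

end

theory Submission
  imports Defs
begin

text \<open>
  The forward direction is direct: \<open>a \<le> a s a\<close> makes \<open>s a\<close> an ordered idempotent with
  \<open>L(s a) = L(a)\<close>, and \<open>s a \<le> a t\<close> turns \<open>a \<le> a s a s a\<close> into \<open>a \<le> a\<^sup>2 t s a\<close>.

  Conversely, \<open>a \<le> a\<^sup>2 s a\<close> gives the ordered idempotent \<open>e = a s a\<close> with \<open>L(e) = L(a)\<close> and
  \<open>e \<in> a S\<close>. The key point is that also \<open>a \<in> (e S]\<close>. Put \<open>u = a s\<close> and \<open>b = u a u\<close>; from
  \<open>b \<le> b\<^sup>2 t b\<close> both \<open>b t b\<close> and \<open>a b\<close> are ordered idempotents generating \<open>L(b)\<close>, so uniqueness
  gives \<open>a b \<in> (b S] \<subseteq> (e S]\<close>, while \<open>a \<le> a b a\<close>. Now let \<open>c = x a\<close> and let \<open>f\<close> be the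
  idempotent \<open>c t c\<close> attached to \<open>c\<close>. Then \<open>f \<le> f e\<close>, so \<open>e f\<close> and \<open>f\<close> are ordered idempotents
  generating the same left ideal, whence \<open>f \<in> (e S]\<close> and \<open>c \<in> (f S] \<subseteq> (e S] \<subseteq> (a S]\<close>.
\<close>

lemma mult_mono_os:
  fixes a b c d :: "'a::ordered_semigroup"
  assumes "a \<le> b" "c \<le> d"
  shows "a * c \<le> b * d"
  by (meson assms mult_left_mono_os mult_right_mono_os order_trans)

lemma principal_left_ideal_subset:
  fixes a b :: "'a::ordered_semigroup"
  assumes "a \<le> x * b"
  shows "principal_left_ideal a \<subseteq> principal_left_ideal b"
proof (rule principal_left_ideal_least(3))
  have "left_ideal (principal_left_ideal b)" "b \<in> principal_left_ideal b"
    by (rule principal_left_ideal_least)+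
  then show "left_ideal (principal_left_ideal b)" "a \<in> principal_left_ideal b"
    using assms unfolding left_ideal_def downset_def by blast+
qed

lemma principal_right_ideal_subset:
  fixes a b :: "'a::ordered_semigroup"
  assumes "a \<le> b * x"
  shows "principal_right_ideal a \<subseteq> principal_right_ideal b"
proof (rule principal_right_ideal_least(3))
  have "right_ideal (principal_right_ideal b)" "b \<in> principal_right_ideal b"
    by (rule principal_right_ideal_least)+
  then show "right_ideal (principal_right_ideal b)" "a \<in> principal_right_ideal b"
    using assms unfolding right_ideal_def downset_def by blast+
qed

lemma principal_left_ideal_eqI:
  fixes a b :: "'a::ordered_semigroup"
  assumes "a \<le> x * b" "b \<le> y * a"
  shows "principal_left_ideal a = principal_left_ideal b"
  using assms principal_left_ideal_subset by blast

lemma green_R_I: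
  fixes a b :: "'a::ordered_semigroup"
  assumes "a \<le> b * x" "b \<le> a * y"
  shows "green_R a b"
  using assms principal_right_ideal_subset unfolding green_R_def by blast

text \<open>Since \<open>e \<le> e * e\<close>, the left ideal (Se] already contains
  \<open>e\<close>, so L(e) lies in it and no separate case \<open>a \<le> e\<close> arises.\<close>

lemma principal_left_ideal_idempotentD:
  fixes a e :: "'a::ordered_semigroup"
  assumes "e \<le> e * e" "a \<in> principal_left_ideal e"
  shows "\<exists>x. a \<le> x * e"
proof -
  have "left_ideal {t. \<exists>x. t \<le> x * e}"
    unfolding left_ideal_def downset_def using assms(1)
    by (auto simp: mult.assoc[symmetric] intro: order_trans)
       (metis mult.assoc mult_left_mono_os)
  then show ?thesis
    using principal_left_ideal_least(3)[of _ e] assms by blast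
qed

lemma principal_right_ideal_idempotentD:
  fixes a e :: "'a::ordered_semigroup"
  assumes "e \<le> e * e" "a \<in> principal_right_ideal e"
  shows "\<exists>x. a \<le> e * x"
proof -
  have "right_ideal {t. \<exists>x. t \<le> e * x}"
    unfolding right_ideal_def downset_def using assms(1)
    by (auto simp: mult.assoc intro: order_trans)
       (metis mult.assoc mult_right_mono_os)
  then show ?thesis
    using principal_right_ideal_least(3)[of _ e] assms by blast
qed

lemma regular_semigroupD:
  fixes a :: "'a::ordered_semigroup"
  assumes "regular_semigroup TYPE('a)"
  shows "\<exists>s. a \<le> a * s * a"
  using assms unfolding regular_semigroup_def downset_def by blast

lemma right_cliffordD:
  fixes a x :: "'a::ordered_semigroup"
  assumes "right_clifford TYPE('a)"
  shows "\<exists>t. x * a \<le> a * t"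
proof -
  have "x * a \<in> downset {s * a | s. True}"
    unfolding downset_def by blast
  then show ?thesis
    using assms unfolding right_clifford_def downset_def by blast
qed

text \<open>This is how R-uniqueness is applied: left divisibility both ways gives L(e) = L(f),
  hence R(e) = R(f), and R(f) lies in (fS] because \<open>f\<close> is an ordered
  idempotent.\<close>

lemma right_inverse_semigroupD:
  fixes e f :: "'a::ordered_semigroup"
  assumes "right_inverse_semigroup TYPE('a)"
    and e: "e \<le> e * e" and f: "f \<le> f * f" and "e \<le> x * f" "f \<le> y * e"
  shows "\<exists>z. e \<le> f * z"
proof -
  have "principal_left_ideal e = principal_left_ideal f"
    using assms(4,5) by (rule principal_left_ideal_eqI)
  then have "green_R e f"
    using assms(1) e f unfolding right_inverse_semigroup_def ordered_idempotents_def by blast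
  then have "e \<in> principal_right_ideal f"
    using principal_right_ideal_least(2)[of e] unfolding green_R_def by simp
  then show ?thesis
    using f by (rule principal_right_ideal_idempotentD[rotated])
qed

lemma right_clifford_imp_right_inverse:
  assumes rc: "right_clifford TYPE('a::ordered_semigroup)"
  shows "right_inverse_semigroup TYPE('a)"
  unfolding right_inverse_semigroup_def
proof (intro conjI allI ballI impI)
  show reg: "regular_semigroup TYPE('a)"
    using rc unfolding right_clifford_def by simp
  fix a :: 'a
  obtain s where s: "a \<le> a * s * a"
    using regular_semigroupD[OF reg] by blast
  show "\<exists>e\<in>ordered_idempotents. principal_left_ideal a = principal_left_ideal e"
  proof (rule bexI)
    show "principal_left_ideal a = principal_left_ideal (s * a)"
    proof (rule principal_left_ideal_eqI)
      show "a \<le> a * (s * a)" using s by (simp add: mult.assoc)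
      show "s * a \<le> s * a" ..
    qed
    show "s * a \<in> ordered_idempotents"
      using mult_left_mono_os[OF s, of s]
      by (simp add: ordered_idempotents_def mult.assoc)
  qed
  fix e f :: 'a
  assume ef: "e \<in> ordered_idempotents" "f \<in> ordered_idempotents"
    "principal_left_ideal e = principal_left_ideal a"
    "principal_left_ideal f = principal_left_ideal a"
  \<comment> \<open>The right Clifford condition turns a left multiple of \<open>h\<close> into a
    right one. Used in both directions, this gives \<open>green_R e f\<close>.\<close>
  have "\<exists>z. g \<le> h * z"
    if "h \<in> ordered_idempotents" "principal_left_ideal g = principal_left_ideal h" for g h :: 'a
  proof -
    have "g \<in> principal_left_ideal h"
      using principal_left_ideal_least(2)[of g] that(2) by simp
    moreover have "h \<le> h * h"
      using that(1) by (simp add: ordered_idempotents_def)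
    ultimately obtain x where x: "g \<le> x * h"
      using principal_left_ideal_idempotentD by metis
    obtain t where "x * h \<le> h * t"
      using right_cliffordD[OF rc] by metis
    then show ?thesis
      using order_trans[OF x] by metis
  qed
  then show "green_R e f"
    using ef green_R_I by metis
qed

lemma right_clifford_square_regular:
  fixes a :: "'a::ordered_semigroup"
  assumes "right_clifford TYPE('a)"
  shows "\<exists>s. a \<le> a * a * s * a"
proof -
  obtain s where s: "a \<le> a * s * a"
    using regular_semigroupD assms unfolding right_clifford_def by blast
  obtain t where t: "s * a \<le> a * t"
    using right_cliffordD[OF assms] by blast
  note s
  also have "a * s * a \<le> a * s * (a * s * a)"
    using s by (rule mult_left_mono_os)
  also have "\<dots> = a * (s * a) * (s * a)"
    by (simp add: mult.assoc)
  also have "\<dots> \<le> a * (a * t) * (s * a)"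
    by (rule mult_mono_os[OF mult_left_mono_os[OF t] order_refl])
  also have "\<dots> = a * a * (t * s) * a"
    by (simp add: mult.assoc)
  finally show ?thesis by blast
qed

text \<open>Needed twice in the converse: for \<open>a\<close>, and for \<open>c = x * a\<close>.
  Uniqueness compares only ordered idempotents, so \<open>a\<close> is reached through
  \<open>a * b\<close>.\<close>

lemma right_inverse_R_related_idempotent:
  fixes a :: "'a::ordered_semigroup"
  assumes ri: "right_inverse_semigroup TYPE('a)"
    and sq: "\<And>a::'a. \<exists>s. a \<le> a * a * s * a"
  shows "\<exists>s p. a \<le> a * (a * s * a) \<and> a \<le> a * s * a * p"
proof -
  obtain s where s: "a \<le> a * a * s * a" using sq by blast
  define u where "u = a * s"
  have a: "a \<le> a * u * a" using s by (simp add: u_def mult.assoc)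
  \<comment> \<open>Substituting \<open>a \<le> a * u * a\<close> into itself yields
    \<open>a \<le> a * b * a\<close>. Moreover \<open>b\<close> begins with
    \<open>u * a = a * s * a\<close>, so its right multiples are right multiples of
    \<open>a * s * a\<close>.\<close>
  define b where "b = u * a * u"
  have aba: "a \<le> a * b * a"
  proof -
    note a
    also have "a * u * a \<le> a * u * (a * u * a)"
      using a by (rule mult_left_mono_os)
    finally show ?thesis by (simp add: b_def mult.assoc)
  qed
  \<comment> \<open>This makes \<open>b\<close>, and so \<open>v\<close>, lie below a left multiple
    of \<open>a * b\<close>.\<close>
  have b: "b \<le> u * a * b"
    using mult_mono_os[OF mult_left_mono_os[OF a, of u] order_refl, of u]
    by (simp add: b_def mult.assoc)
  obtain t where t: "b \<le> b * b * t * b" using sq by blast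
  define v where "v = b * t * b"
  have bv: "b \<le> b * v" using t by (simp add: v_def mult.assoc)
  have v: "v \<le> v * v"
    using mult_left_mono_os[OF bv, of "b * t"] by (simp add: v_def mult.assoc)
  have ab: "a * b \<le> a * b * (a * b)"
    using mult_right_mono_os[OF aba, of b] by (simp add: mult.assoc)
  have "a * b \<le> a * b * v"
    using mult_left_mono_os[OF bv, of a] by (simp add: mult.assoc)
  moreover have "v \<le> b * t * u * (a * b)"
    using mult_left_mono_os[OF b, of "b * t"] by (simp add: v_def mult.assoc)
  ultimately obtain z where "a * b \<le> v * z"
    using right_inverse_semigroupD[OF ri ab v] by blast
  then have "a \<le> v * z * a"
    by (rule order_trans[OF aba mult_right_mono_os])
  also have "\<dots> = a * s * a * (u * t * b * z * a)"
    by (simp add: v_def b_def u_def mult.assoc)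
  finally show ?thesis
    using s by (auto simp: mult.assoc)
qed

lemma right_inverse_imp_right_clifford:
  assumes ri: "right_inverse_semigroup TYPE('a::ordered_semigroup)"
    and sq: "\<And>a::'a. \<exists>s. a \<le> a * a * s * a"
  shows "right_clifford TYPE('a)"
proof -
  have main: "\<exists>w. x * a \<le> a * w" for x a :: 'a
  proof -
    obtain s where s: "a \<le> a * (a * s * a)"
      using right_inverse_R_related_idempotent[OF ri sq] by blast
    define e where "e = a * s * a"
    define c where "c = x * a"
    obtain t p where t: "c \<le> c * (c * t * c)" and p: "c \<le> c * t * c * p"
      using right_inverse_R_related_idempotent[OF ri sq] by blast
    define f where "f = c * t * c"
    have f: "f \<le> f * f"
      using mult_left_mono_os[OF t, of "c * t"] by (simp add: f_def mult.assoc)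
    \<comment> \<open>\<open>f\<close> ends in \<open>a\<close>, and
      \<open>a \<le> a * e\<close>.\<close>
    have "f \<le> f * e"
      using mult_left_mono_os[OF s, of "c * t * x"]
      by (simp add: f_def e_def c_def mult.assoc)
    then have fef: "f \<le> f * e * f"
      by (rule order_trans[OF f mult_right_mono_os])
    have ef: "e * f \<le> e * f * (e * f)"
      using mult_left_mono_os[OF fef, of e] by (simp add: mult.assoc)
    \<comment> \<open>The left multipliers are \<open>f\<close> and \<open>e\<close>:
      \<open>f \<le> f * (e * f)\<close> and \<open>e * f \<le> e * f\<close>.\<close>
    obtain z where z: "f \<le> e * f * z"
      using right_inverse_semigroupD[OF ri f ef, of f e] fef by (auto simp: mult.assoc)
    have "c \<le> f * p" using p by (simp add: f_def)
    also have "\<dots> \<le> e * f * z * p" using z by (rule mult_right_mono_os)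
    also have "\<dots> = a * (s * a * f * z * p)" by (simp add: e_def mult.assoc)
    finally show ?thesis unfolding c_def by blast
  qed
  have "downset {s * a | s. True} \<subseteq> downset {a * s | s. True}" for a :: 'a
  proof
    fix y assume "y \<in> downset {s * a | s. True}"
    then obtain x where x: "y \<le> x * a" unfolding downset_def by blast
    obtain w where "x * a \<le> a * w" using main by metis
    with x have "y \<le> a * w" by (rule order_trans)
    then show "y \<in> downset {a * s | s. True}" unfolding downset_def by blast
  qed
  then show ?thesis
    using ri unfolding right_clifford_def right_inverse_semigroup_def by blast
qed

theorem theorem3p11:
  assumes "\<not> has_zero TYPE('a::ordered_semigroup)"
  shows "right_clifford TYPE('a) \<longleftrightarrow>
    right_inverse_semigroup TYPE('a) \<and>
    (\<forall>a::'a. a \<in> downset {a * a * s * a | s. True})"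
proof -
  have "a \<in> downset {a * a * s * a | s. True} \<longleftrightarrow> (\<exists>s. a \<le> a * a * s * a)" for a :: 'a
    unfolding downset_def by blast
  then show ?thesis
    using right_clifford_imp_right_inverse right_clifford_square_regular
      right_inverse_imp_right_clifford by blast
qed

end
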